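(* For every integer $n\ge 1$ there is an explicit bijection between the set of Hardinian arrays of size $n\times n$ with parameter $r=1$ and the set of pairs of compositions of $n$ in which both compositions have at least two parts and the first parts of the two compositions are equal.
   Context: A composition of a positive integer $n$ is a finite sequence of positive integers (parts) with sum $n$; a pair of compositions of $n$ is an ordered pair of compositions of $n$ (possibly with different numbers of parts). For a positive integer $r$, a Hardinian array of size $n\times k$ with parameter $r$ is an $n\times k$ array of integers such that: (1) the entry in position $(1,1)$ is $0$ and the entry in position $(n,k)$ is $\max(n,k)-r-1$; (2) the entry in position $(i,j)$ must equal, or be one more than, each of the entries in positions $(i-1,j)$, $(i,j-1)$ and $(i-1,j-1)$ (whenever these positions exist); (3) the entry in position $(i,j)$ must be within $r$ of $\max(i,j)-1$, i.e. differ from it by at most $r$ in absolute value. *)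

theory Defs
  imports Main "HOL-Library.FuncSet"
begin

(* Arrays of size n x k are functions on the index set {1..n} x {1..k}, extended by
   undefined outside it, so that distinct functions are distinct arrays.
   Truncated subtraction is harmless: index 0 lies outside the index set. *)
definition hardinian_arrays :: "nat \<Rightarrow> nat \<Rightarrow> nat \<Rightarrow> (nat \<times> nat \<Rightarrow> int) set" where
  "hardinian_arrays r n k =
     {H \<in> ({1..n} \<times> {1..k}) \<rightarrow>\<^sub>E UNIV.
        H (1, 1) = 0 \<and>
        H (n, k) = int (max n k) - int r - 1 \<and>
        (\<forall>i\<in>{1..n}. \<forall>j\<in>{1..k}.
           (\<forall>p \<in> {(i - 1, j), (i, j - 1), (i - 1, j - 1)} \<inter> {1..n} \<times> {1..k}.
              H (i, j) = H p \<or> H (i, j) = H p + 1) \<and>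
           \<bar>H (i, j) - (int (max i j) - 1)\<bar> \<le> int r)}"

definition compositions :: "nat \<Rightarrow> nat list set" where
  "compositions n = {xs. (\<forall>x\<in>set xs. 0 < x) \<and> sum_list xs = n}"

definition composition_pairs :: "nat \<Rightarrow> (nat list \<times> nat list) set" where
  "composition_pairs n =
     {(xs, ys). xs \<in> compositions n \<and> ys \<in> compositions n \<and>
        2 \<le> length xs \<and> 2 \<le> length ys \<and> hd xs = hd ys}"

(* The explicit bijection.  For r = 1 every entry is max i j - 1 or max i j - 2; call the
   entry deficient in the second case.  On and above the diagonal, deficient entries stay
   deficient when moving right or diagonally down-right.  Let d be the first deficient
   diagonal index, and for i < d let t i be the first deficient column j >= i of row i.
   Then t 1, ..., t (d - 1) increases weakly in steps of at most 1 and ends in d, so the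
   multiplicities of the values t 1, t 1 + 1, ..., d form a composition of d - 1;
   prefixing n - d + 1 gives a composition of n.  The part below the diagonal is treated by
   transposition, with the same d. *)

definition first_deficient_diag :: "(nat \<times> nat \<Rightarrow> int) \<Rightarrow> nat" where
  "first_deficient_diag H = (LEAST d. 1 \<le> d \<and> H (d, d) = int d - 2)"

definition first_deficient_col :: "(nat \<times> nat \<Rightarrow> int) \<Rightarrow> nat \<Rightarrow> nat" where
  "first_deficient_col H i = (LEAST j. i \<le> j \<and> H (i, j) = int j - 2)"

definition upper_composition :: "nat \<Rightarrow> (nat \<times> nat \<Rightarrow> int) \<Rightarrow> nat list" where
  "upper_composition n H =
     (let d = first_deficient_diag H
      in (n - d + 1) #
         map (\<lambda>j. card {i \<in> {1..<d}. first_deficient_col H i = j})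
             [first_deficient_col H 1..<d + 1])"

definition hardinian_to_compositions :: "nat \<Rightarrow> (nat \<times> nat \<Rightarrow> int) \<Rightarrow> nat list \<times> nat list" where
  "hardinian_to_compositions n H =
     (upper_composition n H, upper_composition n (\<lambda>(i, j). H (j, i)))"

end

theory Submission
  imports Defs
begin

text \<open>
  In a Hardinian array with \<open>r = 1\<close> no entry exceeds \<open>max i j - 1\<close>, since a diagonal move
  followed by moves along a row or column reaches \<open>(i, j)\<close> from \<open>(1, 1)\<close> in \<open>max i j - 1\<close> steps.
  Hence the array is given by its set of deficient entries, and the conditions on the upper half
  say exactly that the first deficient columns form a staircase: they increase by \<open>0\<close> or \<open>1\<close> from
  row to row and meet the diagonal at \<open>d\<close>. The two halves interact only through \<open>d\<close>. A staircase
  is determined by the multiplicities of its values before \<open>d\<close>, which can be any composition of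
  \<open>d - 1\<close>.
\<close>

section \<open>Staircases and the multiplicities of their values\<close>

text \<open>The meeting point \<open>d\<close> with the diagonal is an explicit parameter because
  the two halves of an array must share it. The range 2 \<le> \<open>d\<close> \<le>
  \<open>n\<close> reflects the prescribed corner entries. Values of \<open>t\<close> outside
  \<open>{1..n}\<close> are unconstrained.\<close>

definition staircase :: "nat \<Rightarrow> nat \<Rightarrow> (nat \<Rightarrow> nat) \<Rightarrow> bool" where
  "staircase n d t \<longleftrightarrow> 2 \<le> d \<and> d \<le> n \<and>
     (\<forall>i\<in>{1..<n}. t i \<le> t (Suc i) \<and> t (Suc i) \<le> Suc (t i)) \<and>
     (\<forall>i\<in>{1..n}. i \<le> t i \<and> (t i = i \<longleftrightarrow> d \<le> i))"

definition multiplicities :: "nat \<Rightarrow> (nat \<Rightarrow> nat) \<Rightarrow> nat list" where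
  "multiplicities d t = map (\<lambda>j. card {i \<in> {1..<d}. t i = j}) [t 1..<d + 1]"

lemma staircase_mono:
  assumes "staircase n d t" "1 \<le> i" "i \<le> j" "j \<le> n"
  shows "t i \<le> t j"
  using assms(3,4)
proof (induction j rule: dec_induct)
  case (step k)
  then have "t k \<le> t (Suc k)" using assms(1,2) by (auto simp: staircase_def)
  then show ?case using step by simp
qed simp

lemma staircase_le_iff:
  assumes "staircase n d t" "i \<in> {1..n}"
  shows "t i \<le> i \<longleftrightarrow> d \<le> i"
  using assms unfolding staircase_def by (metis le_antisym order_refl)

text \<open>\<open>t (d - 1)\<close> lies strictly above \<open>d - 1\<close>, but by monotonicity
  it is at most \<open>t d = d\<close>.\<close>

lemma staircase_last:
  assumes "staircase n d t"
  shows "t (d - 1) = d"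
proof -
  have d: "2 \<le> d" "d \<le> n" using assms by (auto simp: staircase_def)
  then have "d - 1 \<in> {1..<n}" "d - 1 \<in> {1..n}" "d \<in> {1..n}" "Suc (d - 1) = d" "\<not> d \<le> d - 1"
    by auto
  then have "t d = d" "t (d - 1) \<le> t d" "d - 1 \<le> t (d - 1)" "t (d - 1) \<noteq> d - 1"
    using assms unfolding staircase_def by (metis order_refl)+
  then show ?thesis by simp
qed

lemma staircase_range:
  assumes "staircase n d t" "i \<in> {1..<d}"
  shows "t i \<in> {t 1..d}"
  using staircase_mono[of n d t 1 i] staircase_mono[of n d t i "d - 1"] staircase_last[of n d t]
    assms by (auto simp: staircase_def)

text \<open>Discrete intermediate value property: at the least \<open>i\<close> with
  \<open>j \<le> t i\<close>, a step of at most 1 cannot jump past \<open>j\<close>.\<close>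

lemma staircase_attains:
  assumes st: "staircase n d t" and j: "t 1 \<le> j" "j \<le> d"
  obtains i where "i \<in> {1..<d}" "t i = j"
proof -
  let ?P = "\<lambda>i. 1 \<le> i \<and> j \<le> t i"
  define i where "i = (LEAST i. ?P i)"
  have d: "?P (d - 1)"
    using st staircase_last[OF st] j by (auto simp: staircase_def)
  have i: "1 \<le> i" "j \<le> t i" unfolding i_def using LeastI[of ?P, OF d] by auto
  have "i \<le> d - 1" unfolding i_def by (rule Least_le[of ?P, OF d])
  moreover have "t i = j"
  proof (cases "i = 1")
    case False
    have "\<not> (1 \<le> i - 1 \<and> j \<le> t (i - 1))"
      unfolding i_def by (rule not_less_Least) (fold i_def, use i in simp)
    with False i have "t (i - 1) < j" by auto
    moreover have "i - 1 \<in> {1..<n}" using st False i \<open>i \<le> d - 1\<close> by (auto simp: staircase_def)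
    then have "t (Suc (i - 1)) \<le> Suc (t (i - 1))" using st unfolding staircase_def by blast
    ultimately show ?thesis using i by simp
  qed (use i j in auto)
  ultimately show ?thesis using that[of i] i st by (auto simp: staircase_def)
qed

text \<open>Every value from \<open>t 1\<close> to \<open>d\<close> is attained, so the parts are
  positive; the fibres of \<open>t\<close> partition \<open>{1..<d}\<close>, so they sum to
  \<open>d - 1\<close>.\<close>

lemma multiplicities_in_compositions:
  assumes st: "staircase n d t"
  shows "multiplicities d t \<in> compositions (d - 1)" "multiplicities d t \<noteq> []"
proof -
  have "0 < card {i \<in> {1..<d}. t i = j}" if "j \<in> {t 1..<d + 1}" for j
  proof -
    have "t 1 \<le> j" "j \<le> d" using that by auto
    then obtain i where "i \<in> {1..<d}" "t i = j" by (rule staircase_attains[OF st])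
    then show ?thesis by (auto simp: card_gt_0_iff)
  qed
  moreover have "(\<Sum>j\<in>{t 1..<d + 1}. card {i \<in> {1..<d}. t i = j}) = d - 1"
  proof -
    have "t ` {1..<d} \<subseteq> {t 1..<d + 1}" using staircase_range[OF st] by force
    from sum.group[OF _ _ this, of "\<lambda>_. 1::nat"] show ?thesis by simp
  qed
  ultimately show "multiplicities d t \<in> compositions (d - 1)"
    by (auto simp: multiplicities_def compositions_def interv_sum_list_conv_sum_set_nat simp del: upt_Suc)
  show "multiplicities d t \<noteq> []"
    using staircase_range[OF st, of 1] st by (auto simp: multiplicities_def staircase_def)
qed

text \<open>Sublevel sets of monotone functions are initial segments. If \<open>u i\<close> exceeded
  \<open>j\<close>, the sublevel set of \<open>u\<close> would end before \<open>i\<close> and be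
  properly contained in that of \<open>t\<close>, contradicting equal cardinalities.\<close>

lemma staircase_le_if_card_eq:
  assumes "staircase n d t" "staircase n d u" "i \<in> {1..<d}"
    and card: "card {i \<in> {1..<d}. t i \<le> j} = card {i \<in> {1..<d}. u i \<le> j}"
    and le: "t i \<le> j"
  shows "u i \<le> j"
proof (rule ccontr)
  assume nle: "\<not> u i \<le> j"
  have "{i \<in> {1..<d}. u i \<le> j} \<subset> {i \<in> {1..<d}. t i \<le> j}"
  proof
    show "{i \<in> {1..<d}. u i \<le> j} \<subseteq> {i \<in> {1..<d}. t i \<le> j}"
    proof clarsimp
      fix k assume k: "Suc 0 \<le> k" "k < d" "u k \<le> j"
      have "k < i"
        using staircase_mono[of n d u i k] assms k nle by (force simp: staircase_def)
      then show "t k \<le> j"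
        using staircase_mono[of n d t k i] assms k by (auto simp: staircase_def)
    qed
  qed (use assms nle in auto)
  from psubset_card_mono[OF _ this] card show False by simp
qed

text \<open>Equal fibre sizes give equal cumulative counts, and these determine a monotone function.
  From \<open>d\<close> on, both staircases follow the diagonal.\<close>

lemma multiplicities_inj:
  assumes st: "staircase n d t" and su: "staircase n d u"
    and eq: "multiplicities d t = multiplicities d u" and i: "i \<in> {1..n}"
  shows "t i = u i"
proof (cases "i < d")
  case False
  then have "d \<le> i" by simp
  then show ?thesis using st su i unfolding staircase_def by metis
next
  case True
  have range: "t k \<in> {t 1..d}" "u k \<in> {u 1..d}" if "k \<in> {1..<d}" for k
    using staircase_range st su that by blast+
  have "1 \<in> {1..<d}" using st by (simp add: staircase_def)
  then have "t 1 \<le> d" "u 1 \<le> d" using range by auto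
  \<comment> \<open>Both lists of values end at \<open>d\<close>, so their lengths fix where they
    start. As \<open>t 1\<close> and \<open>u 1\<close> are at most \<open>d\<close>, no subtraction
    is truncated.\<close>
  moreover have "d + 1 - t 1 = d + 1 - u 1"
    using arg_cong[OF eq, of length] by (simp add: multiplicities_def del: upt_Suc)
  ultimately have 1: "t 1 = u 1" by simp
  have fib: "card {i \<in> {1..<d}. t i = j} = card {i \<in> {1..<d}. u i = j}" for j
  proof (cases "j \<in> {t 1..d}")
    case True
    then have "j \<in> set [t 1..<d + 1]" by auto
    with eq 1 show ?thesis by (simp only: multiplicities_def map_eq_conv)
  next
    case False
    then have "{i \<in> {1..<d}. t i = j} = {}" "{i \<in> {1..<d}. u i = j} = {}"
      using range 1 by force+
    then show ?thesis by (simp only:)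
  qed
  have sum: "card {i \<in> {1..<d}. v i \<le> j} = (\<Sum>k\<le>j. card {i \<in> {1..<d}. v i = k})"
    for v :: "nat \<Rightarrow> nat" and j
  proof -
    have "{x \<in> {i \<in> {1..<d}. v i \<le> j}. v x = k} = {i \<in> {1..<d}. v i = k}" if "k \<in> {..j}" for k
      using that by auto
    moreover have "v ` {i \<in> {1..<d}. v i \<le> j} \<subseteq> {..j}" by auto
    from sum.group[OF _ _ this, of "\<lambda>_. 1::nat"]
    have "card {i \<in> {1..<d}. v i \<le> j} = (\<Sum>k\<le>j. card {x \<in> {i \<in> {1..<d}. v i \<le> j}. v x = k})"
      by simp
    ultimately show ?thesis by (simp cong: sum.cong_simp)
  qed
  have card: "card {i \<in> {1..<d}. t i \<le> j} = card {i \<in> {1..<d}. u i \<le> j}" for j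
    by (simp only: sum fib)
  show ?thesis
    \<comment> \<open>The threshold \<open>t i\<close> yields \<open>u i \<le> t i\<close>, and the
      threshold \<open>u i\<close> yields the reverse inequality.\<close>
    using staircase_le_if_card_eq[OF st su _ card, of i "t i"]
      staircase_le_if_card_eq[OF su st _ card[symmetric], of i "u i"] True i by auto
qed

section \<open>Staircases from compositions\<close>

lemma sum_list_take_strict_mono:
  fixes zs :: "nat list"
  assumes "\<forall>x\<in>set zs. 0 < x" "k < l" "l \<le> length zs"
  shows "sum_list (take k zs) < sum_list (take l zs)"
  using assms(2,3)
proof (induction l)
  case (Suc l)
  then have "sum_list (take (Suc l) zs) = sum_list (take l zs) + zs ! l" "0 < zs ! l"
    using assms(1) by (auto simp: take_Suc_conv_app_nth)
  then show ?case using Suc by (cases "k = l") auto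
qed simp

text \<open>The partial sums of \<open>zs\<close> cut \<open>{1..<d}\<close> into consecutive blocks
  whose sizes are the parts; the staircase is constant on each block and rises by 1 between
  blocks.\<close>

lemma obtain_staircase:
  assumes d: "2 \<le> d" "d \<le> n" and zs: "zs \<in> compositions (d - 1)"
  obtains t where "staircase n d t" "multiplicities d t = zs"
proof -
  define S where "S k = sum_list (take k zs)" for k
  define L where "L = length zs"
  have pos: "\<forall>x\<in>set zs. 0 < x" and sum: "sum_list zs = d - 1"
    using zs by (auto simp: compositions_def)
  have SL: "S L = d - 1" by (simp add: S_def L_def sum)
  have S0: "S 0 = 0" by (simp add: S_def)
  have S_Suc: "S (Suc k) = S k + zs ! k" if "k < L" for k
    using that by (simp add: S_def L_def take_Suc_conv_app_nth)
  have S_less: "S k < S l" if "k < l" "l \<le> L" for k l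
    using sum_list_take_strict_mono[OF pos] that by (simp add: S_def L_def)
  have S_ge: "k \<le> S k" if "k \<le> L" for k
    using that
  proof (induction k)
    case (Suc k)
    then show ?case using S_less[of k "Suc k"] by simp
  qed simp
  have "L \<noteq> 0" using SL S0 d by (intro notI) auto
  \<comment> \<open>Positive parts cannot outnumber their sum; this keeps the offset
    \<open>d - L\<close> used below from being truncated.\<close>
  have L_le: "L \<le> d - 1" using S_ge[of L] SL by simp
  \<comment> \<open>\<open>p i\<close> is the index, counted from 0, of the block containing
    \<open>i\<close>; block \<open>k\<close> is \<open>{S k<..S (Suc k)}\<close>.\<close>
  define p where "p i = (LEAST k. i \<le> S (Suc k))" for i
  have p: "p i < L" "S (p i) < i" "i \<le> S (Suc (p i))" if "i \<in> {1..<d}" for i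
  proof -
    have L: "i \<le> S (Suc (L - 1))" using that SL \<open>L \<noteq> 0\<close> by auto
    show "i \<le> S (Suc (p i))" unfolding p_def by (rule LeastI[of _ "L - 1"], rule L)
    have "p i \<le> L - 1" unfolding p_def by (rule Least_le, rule L)
    then show "p i < L" using \<open>L \<noteq> 0\<close> by simp
    show "S (p i) < i"
    proof (cases "p i")
      case 0
      then show ?thesis using that S0 by simp
    next
      case (Suc k)
      then have "\<not> i \<le> S (Suc k)" using not_less_Least[of k "\<lambda>k. i \<le> S (Suc k)"] by (simp add: p_def)
      then show ?thesis using Suc by simp
    qed
  qed
  have p_eq: "p i = k" if "i \<in> {1..<d}" "k < L" "S k < i" "i \<le> S (Suc k)" for i k
  proof -
    have "\<not> Suc (p i) \<le> k"
      using that p[OF that(1)] S_less[of "Suc (p i)" k] by (cases "Suc (p i) = k") auto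
    moreover have "\<not> Suc k \<le> p i"
      using that p[OF that(1)] S_less[of "Suc k" "p i"] by (cases "Suc k = p i") auto
    ultimately show ?thesis by simp
  qed
  have p_step: "p (Suc i) = p i \<or> p (Suc i) = Suc (p i)" if i: "1 \<le> i" "Suc i < d" for i
  proof (cases "Suc i \<le> S (Suc (p i))")
    case True
    then show ?thesis using p_eq[of "Suc i" "p i"] p[of i] i by auto
  next
    case False
    then have *: "i = S (Suc (p i))" using p[of i] i by auto
    \<comment> \<open>Here \<open>i\<close> ends its block. Since \<open>i < d - 1\<close>, this is
      not the last block, and the next one is nonempty and so begins with
      \<open>Suc i\<close>.\<close>
    have "Suc (p i) \<noteq> L" using * SL i by auto
    then have L: "Suc (p i) < L" using p[of i] i by auto
    then have "S (Suc (p i)) < S (Suc (Suc (p i)))" using S_less by simp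
    then show ?thesis using p_eq[of "Suc i" "Suc (p i)"] L * i by auto
  qed
  \<comment> \<open>The offset \<open>d - L\<close> is chosen so that the last block, of index
    \<open>L - 1\<close>, receives the value \<open>d\<close>.\<close>
  define t where "t i = (if i < d then d - L + Suc (p i) else i)" for i
  have p1: "p 1 = 0" using p_eq[of 1 0] S0 S_less[of 0 1] \<open>L \<noteq> 0\<close> d by auto
  have p_last: "p (d - 1) = L - 1"
    using p_eq[of "d - 1" "L - 1"] SL S_less[of "L - 1" L] \<open>L \<noteq> 0\<close> d by auto
  have t_last: "t (d - 1) = d" using d p_last \<open>L \<noteq> 0\<close> L_le by (simp add: t_def)
  have t_step: "t i \<le> t (Suc i) \<and> t (Suc i) \<le> Suc (t i)" if "1 \<le> i" for i
  proof -
    consider "Suc i < d" | "Suc i = d" | "d \<le> i" by linarith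
    then show ?thesis
    proof cases
      case 1
      then show ?thesis using p_step[of i] that by (auto simp: t_def)
    next
      case 2
      then have "t i = d" using t_last by auto
      then show ?thesis using 2 by (simp add: t_def)
    qed (simp add: t_def)
  qed
  have t_add: "t (i + k) \<le> t i + k" if "1 \<le> i" for i k
  proof (induction k)
    case (Suc k)
    then show ?case using t_step[of "i + k"] that by auto
  qed simp
  \<comment> \<open>Starting from \<open>t i\<close>, the remaining \<open>d - 1 - i\<close> steps
    of at most 1 must reach \<open>d\<close>, which forces \<open>t i\<close> to be at least
    \<open>i + 1\<close>.\<close>
  have t_gt: "i < t i" if "i \<in> {1..<d}" for i
    using t_add[of i "d - 1 - i"] t_last that by auto
  have st: "staircase n d t"
  proof -
    have "i \<le> t i \<and> (t i = i \<longleftrightarrow> d \<le> i)" if "i \<in> {1..n}" for i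
      using t_gt[of i] that by (cases "i < d") (auto simp: t_def)
    then show ?thesis using d t_step by (simp add: staircase_def)
  qed
  have fib: "{i \<in> {1..<d}. t i = d - L + Suc k} = {S k<..S (Suc k)}" if "k < L" for k
  proof -
    have "S (Suc k) \<le> d - 1"
      using S_less[of "Suc k" L] SL that by (cases "Suc k = L") auto
    then have "i \<in> {1..<d}" if "i \<in> {S k<..S (Suc k)}" for i using that d by auto
    moreover have "t i = d - L + Suc k \<longleftrightarrow> i \<in> {S k<..S (Suc k)}" if "i \<in> {1..<d}" for i
    proof -
      have "t i = d - L + Suc k \<longleftrightarrow> p i = k" using that by (simp add: t_def)
      also have "\<dots> \<longleftrightarrow> i \<in> {S k<..S (Suc k)}"
        using p[OF that] p_eq[OF that \<open>k < L\<close>] by (metis greaterThanAtMost_iff)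
      finally show ?thesis .
    qed
    ultimately show ?thesis by blast
  qed
  have t1: "t 1 = d - L + 1" using p1 d by (simp add: t_def)
  have len: "length (multiplicities d t) = L"
    using L_le d unfolding multiplicities_def t1 by (simp del: upt_Suc)
  have "multiplicities d t = zs"
  proof (rule nth_equalityI)
    fix k assume "k < length (multiplicities d t)"
    then have k: "k < L" using len by simp
    then have "multiplicities d t ! k = card {i \<in> {1..<d}. t i = d - L + Suc k}"
      using L_le unfolding multiplicities_def t1 by (simp del: upt_Suc)
    then show "multiplicities d t ! k = zs ! k"
      unfolding fib[OF k] using S_Suc[OF k] by simp
  qed (simp add: len L_def)
  with st show ?thesis by (rule that)
qed

section \<open>Transposition and entry bounds for Hardinian arrays\<close>

lemma hardinian_step:
  assumes "H \<in> hardinian_arrays r n k" "i \<in> {1..n}" "j \<in> {1..k}"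
    and "p \<in> {(i - 1, j), (i, j - 1), (i - 1, j - 1)}" "p \<in> {1..n} \<times> {1..k}"
  shows "H (i, j) = H p \<or> H (i, j) = H p + 1"
  using assms unfolding hardinian_arrays_def by blast

text \<open>The defining conditions are symmetric in rows and columns; this carries results on the
  upper half over to the lower half.\<close>

lemma hardinian_transpose:
  assumes "H \<in> hardinian_arrays r n k"
  shows "(\<lambda>(i, j). H (j, i)) \<in> hardinian_arrays r k n"
proof -
  have "\<forall>p \<in> {(i - 1, j), (i, j - 1), (i - 1, j - 1)} \<inter> {1..k} \<times> {1..n}.
      H (j, i) = (\<lambda>(i, j). H (j, i)) p \<or> H (j, i) = (\<lambda>(i, j). H (j, i)) p + 1"
    if "i \<in> {1..k}" "j \<in> {1..n}" for i j
    using hardinian_step[OF assms that(2,1)] by auto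
  moreover have "(\<lambda>(i, j). H (j, i)) \<in> ({1..k} \<times> {1..n}) \<rightarrow>\<^sub>E UNIV"
    using assms by (auto simp: hardinian_arrays_def PiE_iff extensional_def)
  moreover have "\<bar>H (j, i) - (int (max i j) - 1)\<bar> \<le> int r" if "i \<in> {1..k}" "j \<in> {1..n}" for i j
    using assms that by (auto simp: hardinian_arrays_def max.commute[of i j])
  ultimately show ?thesis
    using assms by (simp add: hardinian_arrays_def max.commute)
qed

lemma hardinian_le:
  assumes H: "H \<in> hardinian_arrays r n k" and "i \<in> {1..n}" "j \<in> {1..k}"
  shows "H (i, j) \<le> int (max i j) - 1"
  using assms(2,3)
proof (induction "i + j" arbitrary: i j rule: less_induct)
  case less
  consider "i = 1" "j = 1" | "1 < j" "i \<le> j" | "1 < i" "j < i" using less.prems by force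
  then show ?case
  proof cases
    case 1
    then show ?thesis using H by (simp add: hardinian_arrays_def)
  next
    case 2
    \<comment> \<open>The predecessor is the diagonal one, or the left one in the first row. Either
      way the maximum of the indices drops by exactly 1, while the entry drops by at most 1.\<close>
    define i' where "i' = (if i = 1 then 1 else i - 1)"
    have "H (i, j) = H (i', j - 1) \<or> H (i, j) = H (i', j - 1) + 1"
      by (rule hardinian_step[OF H less.prems]) (use 2 less.prems in \<open>auto simp: i'_def\<close>)
    moreover have "H (i', j - 1) \<le> int (max i' (j - 1)) - 1"
      by (rule less.hyps) (use 2 less.prems in \<open>auto simp: i'_def\<close>)
    moreover have "max i' (j - 1) + 1 \<le> max i j" using 2 by (auto simp: i'_def)
    ultimately show ?thesis by linarith
  next
    case 3
    define j' where "j' = (if j = 1 then 1 else j - 1)"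
    have "H (i, j) = H (i - 1, j') \<or> H (i, j) = H (i - 1, j') + 1"
      by (rule hardinian_step[OF H less.prems]) (use 3 less.prems in \<open>auto simp: j'_def\<close>)
    moreover have "H (i - 1, j') \<le> int (max (i - 1) j') - 1"
      by (rule less.hyps) (use 3 less.prems in \<open>auto simp: j'_def\<close>)
    moreover have "max (i - 1) j' + 1 \<le> max i j" using 3 by (auto simp: j'_def)
    ultimately show ?thesis by linarith
  qed
qed

lemma hardinian_cases:
  assumes H: "H \<in> hardinian_arrays 1 n k" and ij: "i \<in> {1..n}" "j \<in> {1..k}"
  shows "H (i, j) = int (max i j) - 1 \<or> H (i, j) = int (max i j) - 2"
proof -
  have "\<bar>H (i, j) - (int (max i j) - 1)\<bar> \<le> 1"
    using H ij by (auto simp: hardinian_arrays_def)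
  with hardinian_le[OF H ij] show ?thesis by linarith
qed

section \<open>Propagation of deficient entries\<close>

text \<open>A move to the right raises the entry by at most 1, while the two admissible values both
  rise by 1, so deficiency cannot be lost.\<close>

lemma deficient_right:
  assumes H: "H \<in> hardinian_arrays 1 n n" and "1 \<le> i" "i \<le> j" "j \<le> k" "k \<le> n"
    and def: "H (i, j) = int j - 2"
  shows "H (i, k) = int k - 2"
  using assms(4,5)
proof (induction k rule: dec_induct)
  case (step k)
  have "H (i, Suc k) = H (i, k) \<or> H (i, Suc k) = H (i, k) + 1"
    by (rule hardinian_step[OF H]) (use step assms in auto)
  moreover have "H (i, Suc k) = int (Suc k) - 1 \<or> H (i, Suc k) = int (Suc k) - 2"
    using hardinian_cases[OF H, of i "Suc k"] step assms by (auto simp: max_def)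
  ultimately show ?case using step by auto
qed (rule def)

lemma deficient_diag:
  assumes H: "H \<in> hardinian_arrays 1 n n" and "1 \<le> i" "i \<le> j" "Suc j \<le> n"
    and def: "H (i, j) = int j - 2"
  shows "H (Suc i, Suc j) = int (Suc j) - 2"
proof -
  have "H (Suc i, Suc j) = H (i, j) \<or> H (Suc i, Suc j) = H (i, j) + 1"
    by (rule hardinian_step[OF H]) (use assms in auto)
  then show ?thesis
    using hardinian_cases[OF H, of "Suc i" "Suc j"] assms by (auto simp: max_def)
qed

text \<open>Entries do not increase when moving up, and above the diagonal the admissible values
  depend only on the column.\<close>

lemma deficient_up:
  assumes H: "H \<in> hardinian_arrays 1 n n" and "1 \<le> i" "Suc i \<le> j" "j \<le> n"
    and def: "H (Suc i, j) = int j - 2"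
  shows "H (i, j) = int j - 2"
proof -
  have "H (Suc i, j) = H (i, j) \<or> H (Suc i, j) = H (i, j) + 1"
    by (rule hardinian_step[OF H]) (use assms in auto)
  moreover have "H (i, j) = int j - 1 \<or> H (i, j) = int j - 2"
    using hardinian_cases[OF H, of i j] \<open>1 \<le> i\<close> \<open>Suc i \<le> j\<close> \<open>j \<le> n\<close> by (simp add: max_def)
  ultimately show ?thesis using def by linarith
qed

text \<open>The prescribed corner entry \<open>int n - 2\<close> is deficient, and deficiency
  spreads up the last column. Hence the least indices defining the first deficient entries
  exist.\<close>

lemma deficient_last_col:
  assumes H: "H \<in> hardinian_arrays 1 n n" and "i \<in> {1..n}"
  shows "H (i, n) = int n - 2"
proof -
  have "i \<le> n" "1 \<le> i" using assms by auto
  then show ?thesis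
  proof (induction i rule: inc_induct)
    case base
    then show ?case using H by (simp add: hardinian_arrays_def)
  next
    case (step m)
    then show ?case using deficient_up[OF H, of m n] by auto
  qed
qed

section \<open>The staircase of first deficient columns\<close>

lemma first_deficient_diag_bounds:
  assumes H: "H \<in> hardinian_arrays 1 n n" and n: "1 \<le> n"
  shows "2 \<le> first_deficient_diag H" "first_deficient_diag H \<le> n"
    and "H (first_deficient_diag H, first_deficient_diag H) = int (first_deficient_diag H) - 2"
proof -
  define d where "d = first_deficient_diag H"
  let ?P = "\<lambda>d. 1 \<le> d \<and> H (d, d) = int d - 2"
  have last: "?P n" using deficient_last_col[OF H, of n] n by simp
  have d: "?P d" unfolding d_def first_deficient_diag_def by (rule LeastI[of ?P, OF last])
  then show "H (d, d) = int d - 2" by simp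
  have "H (1, 1) = 0" using H by (simp add: hardinian_arrays_def)
  with d have "d \<noteq> 1" by auto
  with d show "2 \<le> d" by simp
  show "d \<le> n" unfolding d_def first_deficient_diag_def by (rule Least_le[of ?P, OF last])
qed

lemma first_deficient_diag_le_iff:
  assumes H: "H \<in> hardinian_arrays 1 n n" and i: "i \<in> {1..n}"
  shows "first_deficient_diag H \<le> i \<longleftrightarrow> H (i, i) = int i - 2"
proof
  assume "H (i, i) = int i - 2"
  then show "first_deficient_diag H \<le> i"
    unfolding first_deficient_diag_def by (intro Least_le) (use i in auto)
next
  have n: "1 \<le> n" using i by simp
  assume "first_deficient_diag H \<le> i"
  then have "i \<le> n \<longrightarrow> H (i, i) = int i - 2"
  proof (induction i rule: dec_induct)
    case (step k)
    then show ?case using deficient_diag[OF H, of k k] first_deficient_diag_bounds[OF H n] by auto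
  qed (simp add: first_deficient_diag_bounds[OF H n])
  then show "H (i, i) = int i - 2" using i by simp
qed

lemma first_deficient_col_bounds:
  assumes H: "H \<in> hardinian_arrays 1 n n" and i: "i \<in> {1..n}"
  shows "i \<le> first_deficient_col H i" "first_deficient_col H i \<le> n"
    and "H (i, first_deficient_col H i) = int (first_deficient_col H i) - 2"
proof -
  let ?P = "\<lambda>j. i \<le> j \<and> H (i, j) = int j - 2"
  have last: "?P n" using deficient_last_col[OF H i] i by simp
  have "?P (first_deficient_col H i)"
    unfolding first_deficient_col_def by (rule LeastI[of ?P, OF last])
  then show "i \<le> first_deficient_col H i"
    "H (i, first_deficient_col H i) = int (first_deficient_col H i) - 2" by auto
  show "first_deficient_col H i \<le> n"
    unfolding first_deficient_col_def by (rule Least_le[of ?P, OF last])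
qed

lemma first_deficient_col_le_iff:
  assumes H: "H \<in> hardinian_arrays 1 n n" and ij: "1 \<le> i" "i \<le> j" "j \<le> n"
  shows "first_deficient_col H i \<le> j \<longleftrightarrow> H (i, j) = int j - 2"
proof
  assume "H (i, j) = int j - 2"
  then show "first_deficient_col H i \<le> j"
    unfolding first_deficient_col_def by (intro Least_le) (use ij in auto)
next
  assume "first_deficient_col H i \<le> j"
  moreover have "i \<in> {1..n}" using ij by simp
  ultimately show "H (i, j) = int j - 2"
    using deficient_right[OF H] first_deficient_col_bounds[OF H] ij by blast
qed

text \<open>Upward propagation makes the columns weakly increasing, diagonal propagation bounds each
  step by 1, and \<open>t i = i\<close> says that the diagonal entry of row \<open>i\<close> is
  deficient.\<close>

lemma staircase_first_deficient_col:
  assumes H: "H \<in> hardinian_arrays 1 n n" and n: "1 \<le> n"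
  shows "staircase n (first_deficient_diag H) (first_deficient_col H)"
proof -
  let ?t = "first_deficient_col H"
  have "?t i \<le> ?t (Suc i)" if "i \<in> {1..<n}" for i
    using first_deficient_col_bounds[OF H, of "Suc i"] deficient_up[OF H, of i "?t (Suc i)"]
      first_deficient_col_le_iff[OF H, of i "?t (Suc i)"] that by auto
  moreover have "?t (Suc i) \<le> Suc (?t i)" if "i \<in> {1..<n}" for i
  proof (cases "?t i = n")
    \<comment> \<open>The diagonal successor would leave the array here, but no first deficient
      column exceeds \<open>n\<close>.\<close>
    case True
    then show ?thesis using first_deficient_col_bounds(2)[OF H, of "Suc i"] that by simp
  next
    case False
    then show ?thesis
      using first_deficient_col_bounds[OF H, of i] deficient_diag[OF H, of i "?t i"]
        first_deficient_col_le_iff[OF H, of "Suc i" "Suc (?t i)"] that by auto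
  qed
  moreover have "i \<le> ?t i \<and> (?t i = i \<longleftrightarrow> first_deficient_diag H \<le> i)" if "i \<in> {1..n}" for i
    using first_deficient_col_bounds(1)[OF H that] first_deficient_col_le_iff[OF H, of i i]
      first_deficient_diag_le_iff[OF H that] that by auto
  ultimately show ?thesis
    using first_deficient_diag_bounds[OF H n] by (simp add: staircase_def)
qed

section \<open>Compositions of an array and injectivity\<close>

lemma upper_composition_eq:
  "upper_composition n H =
     (n - first_deficient_diag H + 1) #
       multiplicities (first_deficient_diag H) (first_deficient_col H)"
  by (simp add: upper_composition_def multiplicities_def Let_def)

lemma upper_composition_in_compositions:
  assumes H: "H \<in> hardinian_arrays 1 n n" and n: "1 \<le> n"
  shows "upper_composition n H \<in> compositions n" "2 \<le> length (upper_composition n H)"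
  using multiplicities_in_compositions[OF staircase_first_deficient_col[OF assms]]
    first_deficient_diag_bounds(1,2)[OF assms]
  by (simp_all add: upper_composition_eq compositions_def Suc_le_eq)

text \<open>The first part gives \<open>d\<close>, the remaining parts give the staircase, and the
  staircase tells which entries on and above the diagonal are deficient.\<close>

lemma upper_composition_determines:
  assumes G: "G \<in> hardinian_arrays 1 n n" and H: "H \<in> hardinian_arrays 1 n n"
    and eq: "upper_composition n G = upper_composition n H"
    and ij: "1 \<le> i" "i \<le> j" "j \<le> n"
  shows "G (i, j) = H (i, j)"
proof -
  have n: "1 \<le> n" using ij by simp
  have d: "first_deficient_diag G = first_deficient_diag H"
    using arg_cong[OF eq, of hd] first_deficient_diag_bounds(2)[OF G n]
      first_deficient_diag_bounds(2)[OF H n]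
    unfolding upper_composition_eq list.sel by linarith
  have "multiplicities (first_deficient_diag H) (first_deficient_col G) =
      multiplicities (first_deficient_diag H) (first_deficient_col H)"
    using arg_cong[OF eq, of tl] unfolding upper_composition_eq list.sel d .
  moreover have "i \<in> {1..n}" using ij by simp
  ultimately have "first_deficient_col G i = first_deficient_col H i"
    by (rule multiplicities_inj[OF staircase_first_deficient_col[OF G n, unfolded d]
        staircase_first_deficient_col[OF H n]])
  then have "G (i, j) = int j - 2 \<longleftrightarrow> H (i, j) = int j - 2"
    using first_deficient_col_le_iff[OF G ij] first_deficient_col_le_iff[OF H ij] by metis
  moreover have "G (i, j) = int j - 1 \<or> G (i, j) = int j - 2"
    "H (i, j) = int j - 1 \<or> H (i, j) = int j - 2"
    using hardinian_cases[OF G, of i j] hardinian_cases[OF H, of i j] ij by (simp_all add: max_def)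
  ultimately show ?thesis by metis
qed

lemma inj_on_hardinian_to_compositions:
  "inj_on (hardinian_to_compositions n) (hardinian_arrays 1 n n)"
proof (rule inj_onI)
  fix G H
  assume G: "G \<in> hardinian_arrays 1 n n" and H: "H \<in> hardinian_arrays 1 n n"
    and eq: "hardinian_to_compositions n G = hardinian_to_compositions n H"
  show "G = H"
  proof
    fix p :: "nat \<times> nat"
    obtain i j where p: "p = (i, j)" by fastforce
    consider "p \<notin> {1..n} \<times> {1..n}" | "1 \<le> i" "i \<le> j" "j \<le> n" | "1 \<le> j" "j \<le> i" "i \<le> n"
      using p by force
    then show "G p = H p"
    proof cases
      case 1
      moreover have "G \<in> {1..n} \<times> {1..n} \<rightarrow>\<^sub>E UNIV" "H \<in> {1..n} \<times> {1..n} \<rightarrow>\<^sub>E UNIV"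
        using G H unfolding hardinian_arrays_def by blast+
      ultimately show ?thesis by (metis PiE_arb)
    next
      case 2
      moreover have "upper_composition n G = upper_composition n H"
        using eq by (simp add: hardinian_to_compositions_def)
      ultimately show ?thesis using upper_composition_determines[OF G H] p by simp
    next
      case 3
      moreover have
        "upper_composition n (\<lambda>(i, j). G (j, i)) = upper_composition n (\<lambda>(i, j). H (j, i))"
        using eq by (simp add: hardinian_to_compositions_def)
      ultimately show ?thesis
        using upper_composition_determines[OF hardinian_transpose[OF G] hardinian_transpose[OF H], of j i]
          p by simp
    qed
  qed
qed

section \<open>Arrays from pairs of staircases\<close>

text \<open>\<open>t\<close> is indexed by rows and governs the diagonal and the part above it;
  \<open>u\<close> is indexed by columns and governs the part below. The restriction makes the array
  undefined outside the index set.\<close>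

definition array_of :: "nat \<Rightarrow> (nat \<Rightarrow> nat) \<Rightarrow> (nat \<Rightarrow> nat) \<Rightarrow> nat \<times> nat \<Rightarrow> int" where
  "array_of n t u = restrict
     (\<lambda>(i, j). if i \<le> j then int j - (if t i \<le> j then 2 else 1)
               else int i - (if u j \<le> i then 2 else 1)) ({1..n} \<times> {1..n})"

lemma array_of_upper:
  "1 \<le> i \<Longrightarrow> i \<le> j \<Longrightarrow> j \<le> n \<Longrightarrow> array_of n t u (i, j) = int j - (if t i \<le> j then 2 else 1)"
  by (simp add: array_of_def)

lemma array_of_lower:
  "1 \<le> j \<Longrightarrow> j < i \<Longrightarrow> i \<le> n \<Longrightarrow> array_of n t u (i, j) = int i - (if u j \<le> i then 2 else 1)"
  by (simp add: array_of_def)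

text \<open>Only the diagonal, which the definition assigns to the first staircase, could break the
  symmetry; there both staircases give deficiency exactly from \<open>d\<close> on.\<close>

lemma array_of_transpose:
  assumes "staircase n d t" "staircase n d u"
  shows "(\<lambda>(i, j). array_of n t u (j, i)) = array_of n u t"
proof
  fix p :: "nat \<times> nat"
  obtain i j where p: "p = (i, j)" by fastforce
  have "array_of n t u (j, i) = array_of n u t (i, j)"
  proof (cases "(i, j) \<in> {1..n} \<times> {1..n}")
    case True
    then have ij: "1 \<le> i" "i \<le> n" "1 \<le> j" "j \<le> n" by auto
    consider "i < j" | "i = j" | "j < i" by linarith
    then show ?thesis
    proof cases
      case 2
      then show ?thesis
        using ij staircase_le_iff[OF assms(1), of i] staircase_le_iff[OF assms(2), of i]
        by (simp add: array_of_upper)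
    qed (use ij in \<open>simp_all add: array_of_upper array_of_lower\<close>)
  next
    case False
    then have "(j, i) \<notin> {1..n} \<times> {1..n}" by blast
    with False show ?thesis unfolding array_of_def by (simp only: restrict_apply if_False)
  qed
  then show "(case p of (i, j) \<Rightarrow> array_of n t u (j, i)) = array_of n u t p"
    by (simp add: p)
qed

lemma array_of_step:
  assumes st: "staircase n d t" and su: "staircase n d u"
    and ij: "1 \<le> i" "i \<le> j" "j \<le> n"
    and p: "p \<in> {(i - 1, j), (i, j - 1), (i - 1, j - 1)} \<inter> {1..n} \<times> {1..n}"
  shows "array_of n t u (i, j) = array_of n t u p \<or> array_of n t u (i, j) = array_of n t u p + 1"
proof -
  have step: "v (i - 1) \<le> v i" "v i \<le> Suc (v (i - 1))" if "staircase n d v" "1 < i" for v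
  proof -
    have "i - 1 \<in> {1..<n}" "Suc (i - 1) = i" using ij that by auto
    then show "v (i - 1) \<le> v i" "v i \<le> Suc (v (i - 1))"
      using that(1) unfolding staircase_def by metis+
  qed
  \<comment> \<open>The left neighbour of a diagonal entry lies below the diagonal and is governed
    by \<open>u\<close>; the common \<open>d\<close> links it to \<open>t\<close>.\<close>
  have diag: "t i \<le> i \<longleftrightarrow> u i \<le> i"
    using staircase_le_iff[OF st, of i] staircase_le_iff[OF su, of i] ij by simp
  have e: "array_of n t u (i, j) = int j - (if t i \<le> j then 2 else 1)"
    using ij by (rule array_of_upper)
  consider "p = (i - 1, j)" "1 < i" | "p = (i, j - 1)" "i < j" | "p = (i, j - 1)" "i = j" "1 < i"
    | "p = (i - 1, j - 1)" "1 < i"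
    using p ij by (cases "i = j") auto
  then show ?thesis
  proof cases
    case 1
    then have "array_of n t u p = int j - (if t (i - 1) \<le> j then 2 else 1)"
      using ij by (simp add: array_of_upper)
    with e step(1)[OF st] 1 show ?thesis by (simp split: if_split)
  next
    case 2
    then have "array_of n t u p = int j - 1 - (if t i \<le> j - 1 then 2 else 1)"
      using ij by (simp add: array_of_upper of_nat_diff)
    with e show ?thesis by (simp split: if_split) linarith
  next
    case 3
    then have "array_of n t u p = int j - (if u (i - 1) \<le> i then 2 else 1)"
      using ij by (simp add: array_of_lower)
    with e step(1)[OF su] diag 3 show ?thesis by (simp split: if_split)
  next
    case 4
    then have "array_of n t u p = int j - 1 - (if t (i - 1) \<le> j - 1 then 2 else 1)"
      using ij by (simp add: array_of_upper of_nat_diff)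
    \<comment> \<open>The bound on the rise of \<open>t\<close> is what carries deficiency along the
      diagonal.\<close>
    with e step(2)[OF st] 4 ij show ?thesis by (simp split: if_split) linarith
  qed
qed

lemma array_of_hardinian:
  assumes st: "staircase n d t" and su: "staircase n d u"
  shows "array_of n t u \<in> hardinian_arrays 1 n n"
proof -
  have "array_of n t u (i, j) = array_of n t u p \<or> array_of n t u (i, j) = array_of n t u p + 1"
    if ij: "i \<in> {1..n}" "j \<in> {1..n}"
      and p: "p \<in> {(i - 1, j), (i, j - 1), (i - 1, j - 1)} \<inter> {1..n} \<times> {1..n}" for i j p
  proof (cases "i \<le> j")
    case True
    then show ?thesis using array_of_step[OF st su] ij p by auto
  next
    case False
    have swap: "array_of n t u (a, b) = array_of n u t (b, a)" for a b
      using fun_cong[OF array_of_transpose[OF su st], of "(a, b)"] by simp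
    obtain a b where ab: "p = (a, b)" by fastforce
    \<comment> \<open>Below the diagonal, the step condition is that of the transposed array, where
      the position lies above the diagonal.\<close>
    have "(b, a) \<in> {(j - 1, i), (j, i - 1), (j - 1, i - 1)} \<inter> {1..n} \<times> {1..n}"
      using p ab by auto
    from array_of_step[OF su st _ _ _ this] show ?thesis
      using False ij ab swap by auto
  qed
  moreover have "array_of n t u (1, 1) = 0" "array_of n t u (n, n) = int n - 2"
  proof -
    have "2 \<le> d" "d \<le> n" using st by (auto simp: staircase_def)
    then show "array_of n t u (1, 1) = 0" "array_of n t u (n, n) = int n - 2"
      using staircase_le_iff[OF st, of 1] staircase_le_iff[OF st, of n]
      by (simp_all add: array_of_upper)
  qed
  moreover have "array_of n t u \<in> ({1..n} \<times> {1..n}) \<rightarrow>\<^sub>E UNIV"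
    unfolding array_of_def by (rule restrict_PiE_iff[THEN iffD2]) simp
  moreover have "\<bar>array_of n t u (i, j) - (int (max i j) - 1)\<bar> \<le> 1"
    if "i \<in> {1..n}" "j \<in> {1..n}" for i j
    using that by (cases "i \<le> j") (simp_all add: array_of_upper array_of_lower)
  ultimately show ?thesis unfolding hardinian_arrays_def by simp
qed

lemma upper_composition_array_of:
  assumes st: "staircase n d t"
  shows "upper_composition n (array_of n t u) = (n - d + 1) # multiplicities d t"
proof -
  have d: "2 \<le> d" "d \<le> n" "t d = d" using st by (auto simp: staircase_def)
  have diag: "first_deficient_diag (array_of n t u) = d"
    unfolding first_deficient_diag_def
  proof (rule Least_equality)
    show "1 \<le> d \<and> array_of n t u (d, d) = int d - 2"
      using d by (simp add: array_of_upper)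
    fix i assume i: "1 \<le> i \<and> array_of n t u (i, i) = int i - 2"
    show "d \<le> i"
    proof (rule ccontr)
      assume "\<not> d \<le> i"
      with d have "i \<le> n" by simp
      then have "t i \<le> i" using array_of_upper[of i i n t u] i by (simp split: if_splits)
      then show False using staircase_le_iff[OF st, of i] \<open>\<not> d \<le> i\<close> \<open>i \<le> n\<close> i by simp
    qed
  qed
  have col: "first_deficient_col (array_of n t u) i = t i" if i: "i \<in> {1..<d}" for i
    unfolding first_deficient_col_def
  proof (rule Least_equality)
    have "t i \<le> n" using staircase_range[OF st i] d by simp
    moreover have "i \<in> {1..n}" using i d by simp
    then have "i \<le> t i" using st unfolding staircase_def by blast
    ultimately show "i \<le> t i \<and> array_of n t u (i, t i) = int (t i) - 2"
      using i by (simp add: array_of_upper)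
    fix j assume j: "i \<le> j \<and> array_of n t u (i, j) = int j - 2"
    show "t i \<le> j"
    \<comment> \<open>The least column is sought among all naturals, so columns beyond the array,
      where the entry is undefined, are compared with \<open>t i \<le> n\<close> instead.\<close>
    proof (cases "j \<le> n")
      case True
      with array_of_upper[of i j n t u] i j show ?thesis by (simp split: if_splits)
    next
      case False
      with \<open>t i \<le> n\<close> show ?thesis by simp
    qed
  qed
  have "{i \<in> {1..<d}. first_deficient_col (array_of n t u) i = j} = {i \<in> {1..<d}. t i = j}" for j
    using col by auto
  moreover have "first_deficient_col (array_of n t u) 1 = t 1" using col d by simp
  ultimately show ?thesis by (simp only: upper_composition_eq diag multiplicities_def)
qed

section \<open>Bijectivity onto the pairs of compositions\<close>

theorem proposition2p7:
  fixes n :: nat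
  assumes "1 \<le> n"
  shows "bij_betw (hardinian_to_compositions n) (hardinian_arrays 1 n n) (composition_pairs n)"
  unfolding bij_betw_def
proof (intro conjI inj_on_hardinian_to_compositions equalityI subsetI)
  fix q assume "q \<in> hardinian_to_compositions n ` hardinian_arrays 1 n n"
  then obtain H where H: "H \<in> hardinian_arrays 1 n n" and q: "q = hardinian_to_compositions n H"
    by blast
  \<comment> \<open>Transposition fixes the diagonal, so the two compositions have the same first
    part.\<close>
  have "first_deficient_diag (\<lambda>(i, j). H (j, i)) = first_deficient_diag H"
    by (simp add: first_deficient_diag_def)
  then show "q \<in> composition_pairs n"
    using upper_composition_in_compositions[OF H assms]
      upper_composition_in_compositions[OF hardinian_transpose[OF H] assms]
    by (simp add: q hardinian_to_compositions_def composition_pairs_def upper_composition_eq)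
next
  fix q assume "q \<in> composition_pairs n"
  then obtain xs ys where q: "q = (xs, ys)" and comp: "xs \<in> compositions n" "ys \<in> compositions n"
    and len: "2 \<le> length xs" "2 \<le> length ys" and hd: "hd xs = hd ys"
    by (auto simp: composition_pairs_def)
  then obtain a x xs' y ys' where xs: "xs = a # x # xs'" and ys: "ys = a # y # ys'"
    by (auto simp: numeral_2_eq_2 Suc_le_length_iff)
  \<comment> \<open>This solves \<open>n - d + 1 = a\<close>. Positivity of \<open>a\<close> gives
    \<open>d \<le> n\<close>, and the positive second part gives \<open>2 \<le> d\<close>.\<close>
  define d where "d = n + 1 - a"
  have d: "2 \<le> d" "d \<le> n" "n - d + 1 = a"
    and tl: "x # xs' \<in> compositions (d - 1)" "y # ys' \<in> compositions (d - 1)"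
    using comp by (auto simp: xs ys d_def compositions_def)
  obtain t where t: "staircase n d t" "multiplicities d t = x # xs'"
    using obtain_staircase[OF d(1,2) tl(1)] .
  obtain u where u: "staircase n d u" "multiplicities d u = y # ys'"
    using obtain_staircase[OF d(1,2) tl(2)] .
  \<comment> \<open>The transposed array is \<open>array_of n u t\<close>, so its upper composition
    is read off from \<open>u\<close>.\<close>
  have "hardinian_to_compositions n (array_of n t u) = q"
    using d(3) t u
    by (simp add: hardinian_to_compositions_def array_of_transpose[OF t(1) u(1)]
        upper_composition_array_of q xs ys)
  then show "q \<in> hardinian_to_compositions n ` hardinian_arrays 1 n n"
    using array_of_hardinian[OF t(1) u(1)] by blast
qed

end
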